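(* Consider the hierarchy for the coefficients $f_\lambda^{(m)}(\tau)$, $\lambda,m\ge0$, described in the context, and assume $\dot f_p^{(l)}(0)=0$ for all $p=0,1,2,\dots$ and $l=0,1,2,\dots$. Then for all $\lambda\ge2$ there exist constants $c_\lambda^\alpha$, $\alpha=0,1,\dots,\left[\frac{\lambda-1}{2}\right]$, depending only on $f_\sigma^{(0)}(0)$ for $\sigma=1,2,\dots,\lambda-2$, such that the following is true, where the choices below are made successively at the orders $2,3,\dots,\lambda$: (i) for $m=0$, the numbers $\theta_0=1,\theta_1,\dots,\theta_{\lambda-1}$ can be chosen so that $$f_\lambda^{(0)}(\tau)=f_\lambda^{(0)}(0)\cos(\tau)+\sum_{\alpha=0}^{\left[\frac{\lambda-1}{2}\right]}c_\lambda^\alpha\cos\big((1+2\alpha)\tau\big);$$ (ii) for every $m\ge1$, by choosing $f_{\lambda-2}^{(m)}(0)=0$, one has $$f_\lambda^{(m)}(\tau)=f_\lambda^{(m)}(0)\cos(\omega_m\tau).$$ (Thus at order $\lambda$ the choices in force are $f_{\xi-2}^{(m)}(0)=0$ for all $2\le\xi\le\lambda$, $m\ge1$, together with the chosen $\theta_0,\dots,\theta_{\lambda-1}$, while all $f_\xi^{(0)}(0)$, $\xi\ge2$, remain free real parameters.)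
   Context: $[x]$ denotes the integer part of $x$. Notation: $\omega_i=i+1$, $e_i(\psi)=\sin(\omega_i\psi)$ for $i=0,1,2,\dots$, and $$C_{ijk}^{(m)}=\frac{2}{\pi}\int_0^\pi\frac{e_i(\psi)e_j(\psi)e_k(\psi)e_m(\psi)}{\sin^2(\psi)}\,d\psi .$$ Dots denote $d/d\tau$. The hierarchy arises from the equation $-\partial_t^2 f+\partial_\psi^2 f=f^3/\sin^2\psi$ on $\mathbb{R}\times(0,\pi)$ with Dirichlet conditions $f(t,0)=f(t,\pi)=0$ by inserting the formal expansions $f(t,\psi)=\sum_{\lambda\ge0}f_\lambda(\tau,\psi)\epsilon^\lambda$, $f_\lambda(\tau,\psi)=\sum_{i\ge0}f_\lambda^{(i)}(\tau)e_i(\psi)$, $\tau=\Omega t$, $\Omega^2=\sum_{\lambda\ge0}\theta_\lambda\epsilon^\lambda$ with $\theta_0=1$, where $f_0=0$ and $f_1(\tau,\psi)=\cos(\tau)e_0(\psi)$. Explicitly: $f_0^{(m)}=0$ and $f_1^{(m)}(\tau)=\delta_0^m\cos(\tau)$ for all $m\ge0$ ($\delta_0^m$ the Kronecker delta), and for all $\lambda\ge2$, $m\ge0$, $$\ddot f_\lambda^{(m)}(\tau)+\omega_m^2 f_\lambda^{(m)}(\tau)=S_\lambda^{(m)}(\tau),$$ $$S_\lambda^{(m)}=-\sum_{i,j,k=0}^\infty C_{ijk}^{(m)}\sum_{\substack{\mu,\nu,\rho\ge1\\ \mu+\nu+\rho=\lambda}}f_\mu^{(i)}f_\nu^{(j)}f_\rho^{(k)}-\sum_{\substack{\mu\ge0,\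 \nu\ge1\\ \mu+\nu=\lambda}}\theta_\nu\,\ddot f_\mu^{(m)} .$$ The initial values $f_\lambda^{(m)}(0)\in\mathbb{R}$ ($\lambda\ge2$, $m\ge0$) and the frequency shifts $\theta_\lambda\in\mathbb{R}$ ($\lambda\ge1$) are parameters that may be prescribed. *)

theory Defs
  imports "HOL-Analysis.Analysis"
begin

definition omega :: "nat \<Rightarrow> real" where
  "omega i = real i + 1"

definition mode :: "nat \<Rightarrow> real \<Rightarrow> real" where
  "mode i \<psi> = sin (omega i * \<psi>)"

text \<open>\<open>coupling i j k m\<close> is $C_{ijk}^{(m)}$. The integrand is $0/0 = 0$ at the two end points,
  which does not affect the integral.\<close>

definition coupling :: "nat \<Rightarrow> nat \<Rightarrow> nat \<Rightarrow> nat \<Rightarrow> real" where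
  "coupling i j k m =
     2 / pi * integral {0..pi} (\<lambda>\<psi>. mode i \<psi> * mode j \<psi> * mode k \<psi> * mode m \<psi> / (sin \<psi>)\<^sup>2)"

text \<open>Throughout, \<open>f l m \<tau>\<close> is $f_l^{(m)}(\tau)$, with the order \<open>l\<close> first and the mode \<open>m\<close> second.\<close>

definition cubic_term :: "(nat \<Rightarrow> nat \<Rightarrow> real \<Rightarrow> real) \<Rightarrow> nat \<Rightarrow> nat \<Rightarrow> real \<Rightarrow> nat \<times> nat \<times> nat \<Rightarrow> real" where
  "cubic_term f l m \<tau> = (\<lambda>(i, j, k). coupling i j k m *
     (\<Sum>(\<mu>, \<nu>, \<rho>) \<in> {(\<mu>, \<nu>, \<rho>). \<mu> \<ge> 1 \<and> \<nu> \<ge> 1 \<and> \<rho> \<ge> 1 \<and> \<mu> + \<nu> + \<rho> = l}.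
        f \<mu> i \<tau> * f \<nu> j \<tau> * f \<rho> k \<tau>))"

definition source :: "(nat \<Rightarrow> real) \<Rightarrow> (nat \<Rightarrow> nat \<Rightarrow> real \<Rightarrow> real) \<Rightarrow> nat \<Rightarrow> nat \<Rightarrow> real \<Rightarrow> real" where
  "source \<theta> f l m \<tau> =
     - (\<Sum>\<^sub>\<infinity>ijk. cubic_term f l m \<tau> ijk)
     - (\<Sum>(\<mu>, \<nu>) \<in> {(\<mu>, \<nu>). \<nu> \<ge> 1 \<and> \<mu> + \<nu> = l}. \<theta> \<nu> * deriv (deriv (f \<mu> m)) \<tau>)"

text \<open>The hierarchy through order \<open>N\<close>; the components of order above \<open>N\<close> are not constrained.
  Convergence of the series over $(i,j,k)$ is demanded explicitly, since the
  infinite sum operator has a default value on divergent series.\<close>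

definition hierarchy_upto :: "nat \<Rightarrow> (nat \<Rightarrow> real) \<Rightarrow> (nat \<Rightarrow> nat \<Rightarrow> real \<Rightarrow> real) \<Rightarrow> bool" where
  "hierarchy_upto N \<theta> f \<longleftrightarrow>
     \<theta> 0 = 1 \<and>
     (\<forall>m \<tau>. f 0 m \<tau> = 0) \<and>
     (\<forall>m \<tau>. f 1 m \<tau> = (if m = 0 then cos \<tau> else 0)) \<and>
     (\<forall>l m \<tau>. 2 \<le> l \<and> l \<le> N \<longrightarrow>
        f l m differentiable (at \<tau>) \<and>
        deriv (f l m) differentiable (at \<tau>) \<and>
        cubic_term f l m \<tau> summable_on UNIV \<and>
        deriv (deriv (f l m)) \<tau> + (omega m)\<^sup>2 * f l m \<tau> = source \<theta> f l m \<tau>)"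

definition initial_data :: "(nat \<Rightarrow> nat \<Rightarrow> real) \<Rightarrow> (nat \<Rightarrow> nat \<Rightarrow> real \<Rightarrow> real) \<Rightarrow> bool" where
  "initial_data a f \<longleftrightarrow> (\<forall>p m. f p m 0 = a p m \<and> deriv (f p m) 0 = 0)"

definition depends_only_on :: "nat set \<Rightarrow> ((nat \<Rightarrow> real) \<Rightarrow> real) \<Rightarrow> bool" where
  "depends_only_on A g \<longleftrightarrow> (\<forall>b b'. (\<forall>\<sigma>\<in>A. b \<sigma> = b' \<sigma>) \<longrightarrow> g b = g b')"

text \<open>The choices in force at order \<open>l\<close>, for initial values \<open>a p m\<close> $= f_p^{(m)}(0)$.
  The values at orders 0 and 1 are those imposed by the hierarchy.
  The rule \<open>\<Theta> \<nu>\<close> selects the shift $\theta_\nu$ from the initial values of the zeroth mode.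
  The same rule is used at all orders: a shift, once chosen, is kept afterwards.\<close>

definition choices_in_force ::
    "nat \<Rightarrow> (nat \<Rightarrow> (nat \<Rightarrow> real) \<Rightarrow> real) \<Rightarrow> (nat \<Rightarrow> nat \<Rightarrow> real) \<Rightarrow> (nat \<Rightarrow> real) \<Rightarrow> bool" where
  "choices_in_force l \<Theta> a \<theta> \<longleftrightarrow>
     (\<forall>m. a 0 m = 0) \<and>
     (\<forall>m. a 1 m = (if m = 0 then 1 else 0)) \<and>
     (\<forall>\<xi>\<in>{2..l}. \<forall>m\<ge>1. a (\<xi> - 2) m = 0) \<and>
     \<theta> 0 = 1 \<and>
     (\<forall>\<nu>\<in>{1..l - 1}. \<theta> \<nu> = \<Theta> \<nu> (\<lambda>\<sigma>. a \<sigma> 0))"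

end

theory Submission
  imports Defs
begin

text \<open>
  With all modes \<open>m \<ge> 1\<close> switched off through order \<open>l - 2\<close>, only the coupling of the zeroth mode
  with itself enters the cubic part of the source at order \<open>l\<close>, and \<open>coupling 0 0 0 m\<close> is the
  Kronecker delta. With \<open>\<theta> 1 = 0\<close> the source then vanishes for \<open>m \<ge> 1\<close>. For \<open>m = 0\<close>
  it equals a residual, built from orders at most \<open>l - 2\<close> and shifts \<open>\<theta> \<nu>\<close> with \<open>\<nu> \<le> l - 2\<close>,
  plus \<open>\<theta> (l - 1) * cos \<tau>\<close>. The residual is a combination of odd harmonics of frequency at most \<open>l\<close>;
  \<open>\<theta> (l - 1)\<close> is chosen to cancel its resonant harmonic \<open>cos \<tau>\<close>, and the remaining
  harmonics are integrated explicitly. Uniqueness for the oscillator equation does the rest.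
\<close>

section \<open>The harmonic oscillator\<close>

text \<open>The energy, squared velocity plus \<open>w\<close>-squared times squared displacement,
  has derivative 0 and starts at 0, so both of its squares vanish.\<close>

lemma oscillator_zero:
  fixes z :: "real \<Rightarrow> real"
  assumes z: "\<And>t. (z has_real_derivative z' t) (at t)"
    and z': "\<And>t. (z' has_real_derivative - w\<^sup>2 * z t) (at t)"
    and "z 0 = 0" "z' 0 = 0" "w \<noteq> 0"
  shows "z t = 0"
proof -
  have "((\<lambda>t. (z' t)\<^sup>2 + w\<^sup>2 * (z t)\<^sup>2) has_real_derivative 0) (at t)" for t
    by (rule derivative_eq_intros z z' refl | simp add: algebra_simps power2_eq_square)+
  then have "(z' t)\<^sup>2 + w\<^sup>2 * (z t)\<^sup>2 = (z' 0)\<^sup>2 + w\<^sup>2 * (z 0)\<^sup>2"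
    by (intro DERIV_isconst_all) auto
  then have "(z' t)\<^sup>2 + (w * z t)\<^sup>2 = 0"
    using assms(3,4) by (simp add: power_mult_distrib)
  then show ?thesis
    using \<open>w \<noteq> 0\<close> by (simp add: sum_power2_eq_zero_iff)
qed

text \<open>The difference of two solutions with the same forcing and data solves the homogeneous
  equation with zero data.\<close>

lemma oscillator_unique:
  fixes x y :: "real \<Rightarrow> real"
  assumes x: "\<And>t. x differentiable (at t)" "\<And>t. deriv x differentiable (at t)"
      "\<And>t. deriv (deriv x) t + w\<^sup>2 * x t = s t"
    and y: "\<And>t. y differentiable (at t)" "\<And>t. deriv y differentiable (at t)"
      "\<And>t. deriv (deriv y) t + w\<^sup>2 * y t = s t"
    and "x 0 = y 0" "deriv x 0 = deriv y 0" "w \<noteq> 0"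
  shows "x = y"
proof
  fix t
  have D: "(h has_real_derivative deriv h t) (at t)" if "h differentiable (at t)"
    for h :: "real \<Rightarrow> real" and t
    using that by (simp add: DERIV_deriv_iff_real_differentiable)
  have "(\<lambda>t. x t - y t) t = 0"
  proof (rule oscillator_zero[where z = "\<lambda>t. x t - y t" and z' = "\<lambda>t. deriv x t - deriv y t"])
    show "((\<lambda>t. x t - y t) has_real_derivative deriv x t - deriv y t) (at t)" for t
      by (intro DERIV_diff D x y)
    have "deriv (deriv x) t - deriv (deriv y) t = - w\<^sup>2 * (x t - y t)" for t
      using x(3)[of t] y(3)[of t] by (simp add: algebra_simps)
    then show "((\<lambda>t. deriv x t - deriv y t) has_real_derivative - w\<^sup>2 * (x t - y t)) (at t)" for t
      using DERIV_diff[OF D[OF x(2)] D[OF y(2)], of t] by simp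
  qed (use assms(7-9) in auto)
  then show "x t = y t" by simp
qed

lemma DERIV_cos_mult:
  "((\<lambda>t. A * cos (w * t)) has_real_derivative - A * w * sin (w * t)) (at t)"
  by (auto intro!: derivative_eq_intros)

lemma DERIV_sin_mult:
  "((\<lambda>t. A * sin (w * t)) has_real_derivative A * w * cos (w * t)) (at t)"
  by (auto intro!: derivative_eq_intros)

lemma deriv_cos_mult: "deriv (\<lambda>t. A * cos (w * t)) = (\<lambda>t. - A * w * sin (w * t))"
  for A w :: real
  by (intro ext DERIV_imp_deriv DERIV_cos_mult)

lemma deriv2_cos_mult: "deriv (deriv (\<lambda>t. A * cos (w * t))) = (\<lambda>t. - A * w\<^sup>2 * cos (w * t))"
  for A w :: real
  unfolding deriv_cos_mult
  by (intro ext DERIV_imp_deriv) (use DERIV_sin_mult[of "- A * w" w] in \<open>simp add: power2_eq_square mult.assoc\<close>)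

section \<open>Sums of odd harmonics\<close>

definition odd_harmonic :: "nat \<Rightarrow> real \<Rightarrow> real" where
  "odd_harmonic \<alpha> \<tau> = cos ((1 + 2 * real \<alpha>) * \<tau>)"

definition odd_cos_sum :: "nat \<Rightarrow> (real \<Rightarrow> real) \<Rightarrow> bool" where
  "odd_cos_sum n h \<longleftrightarrow> (\<exists>c. \<forall>\<tau>. h \<tau> = (\<Sum>\<alpha>\<le>n. c \<alpha> * odd_harmonic \<alpha> \<tau>))"

text \<open>Choosing by \<open>SOME\<close> makes the coefficients a function of \<open>n\<close>
  and \<open>h\<close> alone. Equal residuals thus get equal coefficients, on which the dependence
  claims rest.\<close>

definition odd_cos_coeffs :: "nat \<Rightarrow> (real \<Rightarrow> real) \<Rightarrow> nat \<Rightarrow> real" where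
  "odd_cos_coeffs n h = (SOME c. \<forall>\<tau>. h \<tau> = (\<Sum>\<alpha>\<le>n. c \<alpha> * odd_harmonic \<alpha> \<tau>))"

lemma odd_cos_sum_coeffs:
  assumes "odd_cos_sum n h"
  shows "h \<tau> = (\<Sum>\<alpha>\<le>n. odd_cos_coeffs n h \<alpha> * odd_harmonic \<alpha> \<tau>)"
  using someI_ex[OF assms[unfolded odd_cos_sum_def]] unfolding odd_cos_coeffs_def by blast

lemma odd_cos_sum_zero: "odd_cos_sum n (\<lambda>\<tau>. 0)"
  unfolding odd_cos_sum_def by (rule exI[of _ "\<lambda>_. 0"]) simp

lemma odd_cos_sum_add:
  assumes "odd_cos_sum n g" "odd_cos_sum n h"
  shows "odd_cos_sum n (\<lambda>\<tau>. g \<tau> + h \<tau>)"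
proof -
  obtain c d where "\<And>\<tau>. g \<tau> = (\<Sum>\<alpha>\<le>n. c \<alpha> * odd_harmonic \<alpha> \<tau>)"
    "\<And>\<tau>. h \<tau> = (\<Sum>\<alpha>\<le>n. d \<alpha> * odd_harmonic \<alpha> \<tau>)"
    using assms unfolding odd_cos_sum_def by blast
  then show ?thesis
    unfolding odd_cos_sum_def
    by (intro exI[of _ "\<lambda>\<alpha>. c \<alpha> + d \<alpha>"]) (simp add: algebra_simps sum.distrib)
qed

lemma odd_cos_sum_scale:
  assumes "odd_cos_sum n h"
  shows "odd_cos_sum n (\<lambda>\<tau>. A * h \<tau>)"
proof -
  obtain c where "\<And>\<tau>. h \<tau> = (\<Sum>\<alpha>\<le>n. c \<alpha> * odd_harmonic \<alpha> \<tau>)"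
    using assms unfolding odd_cos_sum_def by blast
  then show ?thesis
    unfolding odd_cos_sum_def
    by (intro exI[of _ "\<lambda>\<alpha>. A * c \<alpha>"]) (simp add: sum_distrib_left mult.assoc)
qed

lemma odd_cos_sum_diff:
  assumes "odd_cos_sum n g" "odd_cos_sum n h"
  shows "odd_cos_sum n (\<lambda>\<tau>. g \<tau> - h \<tau>)"
  using odd_cos_sum_add[OF assms(1) odd_cos_sum_scale[OF assms(2), of "-1"]] by simp

lemma odd_cos_sum_sum:
  assumes "\<And>i. i \<in> I \<Longrightarrow> odd_cos_sum n (h i)"
  shows "odd_cos_sum n (\<lambda>\<tau>. \<Sum>i\<in>I. h i \<tau>)"
  using assms
  by (induction I rule: infinite_finite_induct) (auto intro: odd_cos_sum_zero odd_cos_sum_add)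

lemma odd_cos_sum_odd_harmonic:
  assumes "\<alpha> \<le> n"
  shows "odd_cos_sum n (odd_harmonic \<alpha>)"
proof -
  have "odd_harmonic \<alpha> \<tau> = (\<Sum>\<beta>\<le>n. (if \<beta> = \<alpha> then 1 else 0) * odd_harmonic \<beta> \<tau>)" for \<tau>
    using assms by (simp add: if_distrib[of "\<lambda>x. x * _"] cong: if_cong)
  then show ?thesis
    unfolding odd_cos_sum_def by (intro exI[of _ "\<lambda>\<beta>. if \<beta> = \<alpha> then 1 else 0"]) blast
qed

text \<open>Product formulas produce signed frequencies. As cosine is even, \<open>k\<close> may be
  replaced by its absolute value, which has the form 2j + 1 with j at most \<open>n\<close>.\<close>

lemma odd_cos_sum_cos:
  fixes k :: int
  assumes "odd k" "\<bar>k\<bar> \<le> 2 * int n + 1"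
  shows "odd_cos_sum n (\<lambda>\<tau>. cos (of_int k * \<tau>))"
proof -
  have "odd \<bar>k\<bar>" using assms by simp
  then obtain j where j: "\<bar>k\<bar> = 2 * j + 1" by (elim oddE)
  have jn: "0 \<le> j" "nat j \<le> n" using j assms by linarith+
  have "cos (of_int k * \<tau>) = odd_harmonic (nat j) \<tau>" for \<tau>
  proof -
    have "cos (of_int k * \<tau>) = cos (of_int \<bar>k\<bar> * \<tau>)"
      by (cases "k \<ge> 0") auto
    also have "\<dots> = odd_harmonic (nat j) \<tau>"
      unfolding j odd_harmonic_def using jn by (simp add: algebra_simps)
    finally show ?thesis .
  qed
  then show ?thesis using odd_cos_sum_odd_harmonic[OF jn(2)] by presburger
qed

lemma odd_cos_sum_mono:
  assumes "odd_cos_sum m h" "m \<le> n"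
  shows "odd_cos_sum n h"
proof -
  have "odd_cos_sum n (\<lambda>\<tau>. \<Sum>\<alpha>\<le>m. c \<alpha> * odd_harmonic \<alpha> \<tau>)" for c
    using assms(2) by (intro odd_cos_sum_sum odd_cos_sum_scale odd_cos_sum_odd_harmonic) auto
  moreover obtain c where "h = (\<lambda>\<tau>. \<Sum>\<alpha>\<le>m. c \<alpha> * odd_harmonic \<alpha> \<tau>)"
    using assms(1) unfolding odd_cos_sum_def by blast
  ultimately show ?thesis by blast
qed

section \<open>Products of three odd cosine sums\<close>

lemma cos_mult3:
  fixes x y z :: real
  shows "cos x * cos y * cos z =
    (1/4) * ((cos (x + y + z) + cos (x + y - z)) + (cos (x - y + z) + cos (x - y - z)))"
  by (simp add: cos_add cos_diff sin_add sin_diff algebra_simps)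

text \<open>Signed sums of three odd integers are odd. Their size is at most 2(\<alpha> + \<beta> +
  \<gamma>) + 3, the top frequency 2n + 1 for n = \<alpha> + \<beta> + \<gamma> + 1.\<close>

lemma odd_cos_sum_mult3_harmonic:
  assumes "\<alpha> + \<beta> + \<gamma> + 1 \<le> n"
  shows "odd_cos_sum n (\<lambda>\<tau>. odd_harmonic \<alpha> \<tau> * odd_harmonic \<beta> \<tau> * odd_harmonic \<gamma> \<tau>)"
proof -
  define x y z where "x = 1 + 2 * int \<alpha>" and "y = 1 + 2 * int \<beta>" and "z = 1 + 2 * int \<gamma>"
  have eq: "odd_harmonic \<alpha> \<tau> * odd_harmonic \<beta> \<tau> * odd_harmonic \<gamma> \<tau> =
      (1/4) * ((cos (of_int (x + y + z) * \<tau>) + cos (of_int (x + y - z) * \<tau>)) +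
        (cos (of_int (x - y + z) * \<tau>) + cos (of_int (x - y - z) * \<tau>)))" for \<tau>
    unfolding odd_harmonic_def cos_mult3 x_def y_def z_def by (simp add: algebra_simps)
  show ?thesis
    unfolding eq
    by (intro odd_cos_sum_scale odd_cos_sum_add odd_cos_sum_cos)
      (use assms in \<open>auto simp: x_def y_def z_def\<close>)
qed

lemma odd_cos_sum_mult3:
  assumes "odd_cos_sum p f" "odd_cos_sum q g" "odd_cos_sum r h" "p + q + r + 1 \<le> n"
  shows "odd_cos_sum n (\<lambda>\<tau>. f \<tau> * g \<tau> * h \<tau>)"
proof -
  obtain c d e where cde: "\<And>\<tau>. f \<tau> = (\<Sum>\<alpha>\<le>p. c \<alpha> * odd_harmonic \<alpha> \<tau>)"
    "\<And>\<tau>. g \<tau> = (\<Sum>\<beta>\<le>q. d \<beta> * odd_harmonic \<beta> \<tau>)"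
    "\<And>\<tau>. h \<tau> = (\<Sum>\<gamma>\<le>r. e \<gamma> * odd_harmonic \<gamma> \<tau>)"
    using assms unfolding odd_cos_sum_def by blast
  have eq: "f \<tau> * g \<tau> * h \<tau> = (\<Sum>\<alpha>\<le>p. \<Sum>\<beta>\<le>q. \<Sum>\<gamma>\<le>r. (c \<alpha> * d \<beta> * e \<gamma>) *
      (odd_harmonic \<alpha> \<tau> * odd_harmonic \<beta> \<tau> * odd_harmonic \<gamma> \<tau>))" for \<tau>
    unfolding cde
    by (simp add: sum_distrib_left sum_distrib_right mult_ac) (subst sum.swap, simp add: mult_ac)
  show ?thesis
    unfolding eq using assms(4)
    by (intro odd_cos_sum_sum odd_cos_sum_scale odd_cos_sum_mult3_harmonic) auto
qed

section \<open>Derivatives of odd cosine sums\<close>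

lemma odd_cos_sum_deriv:
  assumes "\<And>\<tau>. h \<tau> = (\<Sum>\<alpha>\<le>n. c \<alpha> * odd_harmonic \<alpha> \<tau>)"
  shows "h differentiable (at \<tau>)" "deriv h differentiable (at \<tau>)" "deriv h 0 = 0"
    and "deriv (deriv h) \<tau> = (\<Sum>\<alpha>\<le>n. - (1 + 2 * real \<alpha>)\<^sup>2 * c \<alpha> * odd_harmonic \<alpha> \<tau>)"
proof -
  let ?h' = "\<lambda>\<tau>. \<Sum>\<alpha>\<le>n. - c \<alpha> * (1 + 2 * real \<alpha>) * sin ((1 + 2 * real \<alpha>) * \<tau>)"
  have h: "h = (\<lambda>\<tau>. \<Sum>\<alpha>\<le>n. c \<alpha> * cos ((1 + 2 * real \<alpha>) * \<tau>))"
    using assms unfolding odd_harmonic_def by blast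
  have 1: "(h has_real_derivative ?h' \<tau>) (at \<tau>)" for \<tau>
    unfolding h by (intro DERIV_sum DERIV_cos_mult)
  then have h': "deriv h = ?h'"
    by (intro ext DERIV_imp_deriv)
  have 2: "(deriv h has_real_derivative
      (\<Sum>\<alpha>\<le>n. - c \<alpha> * (1 + 2 * real \<alpha>) * (1 + 2 * real \<alpha>) * cos ((1 + 2 * real \<alpha>) * \<tau>))) (at \<tau>)" for \<tau>
    unfolding h' by (intro DERIV_sum DERIV_sin_mult)
  show "h differentiable (at \<tau>)" "deriv h differentiable (at \<tau>)"
    using 1 2 real_differentiable_def by blast+
  show "deriv h 0 = 0"
    unfolding h' by simp
  show "deriv (deriv h) \<tau> = (\<Sum>\<alpha>\<le>n. - (1 + 2 * real \<alpha>)\<^sup>2 * c \<alpha> * odd_harmonic \<alpha> \<tau>)"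
    unfolding DERIV_imp_deriv[OF 2] odd_harmonic_def
    by (intro sum.cong refl) (simp add: power2_eq_square mult_ac)
qed

lemma odd_cos_sum_deriv2:
  assumes "odd_cos_sum n h"
  shows "odd_cos_sum n (deriv (deriv h))"
proof -
  obtain c where "\<And>\<tau>. h \<tau> = (\<Sum>\<alpha>\<le>n. c \<alpha> * odd_harmonic \<alpha> \<tau>)"
    using assms unfolding odd_cos_sum_def by blast
  from odd_cos_sum_deriv(4)[OF this] show ?thesis
    unfolding odd_cos_sum_def by (intro exI[of _ "\<lambda>\<alpha>. - (1 + 2 * real \<alpha>)\<^sup>2 * c \<alpha>"]) blast
qed

section \<open>The source\<close>

text \<open>The denominator cancels two of the sines. What remains is the orthogonality of
  \<open>mode 0\<close> and \<open>mode m\<close> on the interval from 0 to pi, with the factor 2/pi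
  as normalisation.\<close>

lemma coupling_0: "coupling 0 0 0 m = (if m = 0 then 1 else 0)"
proof -
  \<comment> \<open>This holds at the zeros of sine too: division by zero gives 0 on the left, and
    the factor \<open>sin x\<close> gives 0 on the right.\<close>
  have eq: "(\<lambda>x. mode 0 x * mode 0 x * mode 0 x * mode m x / (sin x)\<^sup>2) =
      (\<lambda>x. sin x * sin ((real m + 1) * x))"
    by (auto simp: fun_eq_iff mode_def omega_def power2_eq_square)
  have "((\<lambda>x. sin x * sin ((real m + 1) * x)) has_integral (if m = 0 then pi / 2 else 0)) {0..pi}"
  proof (cases "m = 0")
    case True
    have "cos x * (cos x * 2) + sin x * (sin x * 2) = 2" for x :: real
      using sin_cos_squared_add[of x] unfolding power2_eq_square by linarith
    then have "((\<lambda>x. (x - sin x * cos x) / 2) has_real_derivative sin x * sin x) (at x within {0..pi})" for x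
      by (auto intro!: derivative_eq_intros simp: algebra_simps)
    then have "((\<lambda>x. sin x * sin x) has_integral
        (pi - sin pi * cos pi) / 2 - (0 - sin 0 * cos 0) / 2) {0..pi}"
      by (intro fundamental_theorem_of_calculus)
        (auto simp: has_real_derivative_iff_has_vector_derivative[symmetric])
    then show ?thesis using True by simp
  next
    case False
    \<comment> \<open>The antiderivative comes from writing the product of sines as a difference of
      cosines of frequencies \<open>m\<close> and \<open>m + 2\<close>; both sine terms vanish at 0
      and pi.\<close>
    let ?F = "\<lambda>x. 1 / (2 * real m) * sin (real m * x) - 1 / (2 * (real m + 2)) * sin ((real m + 2) * x)"
    have *: "sin x * sin ((real m + 1) * x) = cos (real m * x) / 2 - cos ((real m + 2) * x) / 2" for x
    proof -
      define y where "y = (real m + 1) * x"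
      have y: "real m * x = y - x" "(real m + 2) * x = y + x"
        unfolding y_def by (simp_all add: algebra_simps)
      show ?thesis
        unfolding y y_def[symmetric] cos_add cos_diff by (simp add: field_simps)
    qed
    have half: "1 / (2 * real m) * real m = 1 / 2" "1 / (2 * (real m + 2)) * (real m + 2) = 1 / 2"
      using False by simp_all
    have "1 / (2 * real m) * real m * cos (real m * x) -
        1 / (2 * (real m + 2)) * (real m + 2) * cos ((real m + 2) * x) = sin x * sin ((real m + 1) * x)" for x
      unfolding * half by simp
    then have "(?F has_real_derivative sin x * sin ((real m + 1) * x)) (at x within {0..pi})" for x
      by (rule DERIV_cong[OF has_field_derivative_at_within[OF DERIV_diff[OF DERIV_sin_mult DERIV_sin_mult]]])
    then have "((\<lambda>x. sin x * sin ((real m + 1) * x)) has_integral ?F pi - ?F 0) {0..pi}"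
      by (intro fundamental_theorem_of_calculus)
        (auto simp: has_real_derivative_iff_has_vector_derivative[symmetric])
    moreover have "sin ((real m + 2) * pi) = 0"
      using sin_npi[of "m + 2"] by (simp add: add.commute)
    ultimately show ?thesis using False by simp
  qed
  then show ?thesis
    unfolding coupling_def eq by (auto dest!: integral_unique)
qed

section \<open>Reduction of the source when the higher modes are switched off\<close>

definition cubic_sum :: "(nat \<Rightarrow> real \<Rightarrow> real) \<Rightarrow> nat \<Rightarrow> real \<Rightarrow> real" where
  "cubic_sum g l \<tau> =
     (\<Sum>(\<mu>, \<nu>, \<rho>) \<in> {(\<mu>, \<nu>, \<rho>). \<mu> \<ge> 1 \<and> \<nu> \<ge> 1 \<and> \<rho> \<ge> 1 \<and> \<mu> + \<nu> + \<rho> = l}. g \<mu> \<tau> * g \<nu> \<tau> * g \<rho> \<tau>)"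

text \<open>The shift sum omits three indices: \<nu> = 1 because \<theta> 1 will be 0, \<nu> = l
  because order 0 vanishes, and \<nu> = l - 1 because it gives the resonant term that is treated
  separately.\<close>

definition residual :: "(nat \<Rightarrow> real) \<Rightarrow> (nat \<Rightarrow> real \<Rightarrow> real) \<Rightarrow> nat \<Rightarrow> real \<Rightarrow> real" where
  "residual \<theta> g l \<tau> = - cubic_sum g l \<tau> - (\<Sum>\<nu>=2..l - 2. \<theta> \<nu> * deriv (deriv (g (l - \<nu>))) \<tau>)"

text \<open>Three positive orders with sum \<open>l\<close> are each at most \<open>l - 2\<close>,
  and so is \<open>l - \<nu>\<close> for \<nu> at least 2. This triangular structure permits
  recursion on the order.\<close>

lemma residual_cong:
  assumes "\<And>\<mu>. 1 \<le> \<mu> \<Longrightarrow> \<mu> \<le> l - 2 \<Longrightarrow> g \<mu> = g' \<mu>"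
    and "\<And>\<nu>. 2 \<le> \<nu> \<Longrightarrow> \<nu> \<le> l - 2 \<Longrightarrow> \<theta> \<nu> = \<theta>' \<nu>"
  shows "residual \<theta> g l = residual \<theta>' g' l"
proof
  fix \<tau>
  have "cubic_sum g l \<tau> = cubic_sum g' l \<tau>"
    unfolding cubic_sum_def using assms(1) by (intro sum.cong refl) auto
  moreover have "(\<Sum>\<nu>=2..l - 2. \<theta> \<nu> * deriv (deriv (g (l - \<nu>))) \<tau>) =
      (\<Sum>\<nu>=2..l - 2. \<theta>' \<nu> * deriv (deriv (g' (l - \<nu>))) \<tau>)"
    using assms by (intro sum.cong refl) auto
  ultimately show "residual \<theta> g l \<tau> = residual \<theta>' g' l \<tau>"
    unfolding residual_def by simp
qed

text \<open>Every triple of modes other than (0, 0, 0) contributes a factor of mode at least 1 and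
  order at most \<open>l - 2\<close>, which is 0. The series therefore has a single term.\<close>

lemma cubic_term_switched_off:
  assumes "\<And>\<mu> i \<tau>. \<mu> \<le> l - 2 \<Longrightarrow> 1 \<le> i \<Longrightarrow> f \<mu> i \<tau> = 0"
  shows "cubic_term f l m \<tau> summable_on UNIV"
    and "(\<Sum>\<^sub>\<infinity>ijk. cubic_term f l m \<tau> ijk) = (if m = 0 then cubic_sum (\<lambda>\<mu>. f \<mu> 0) l \<tau> else 0)"
proof -
  have 0: "cubic_term f l m \<tau> ijk = 0" if "ijk \<noteq> (0, 0, 0)" for ijk
  proof -
    obtain i j k where ijk: "ijk = (i, j, k)" by (cases ijk)
    have "f \<mu> i \<tau> * f \<nu> j \<tau> * f \<rho> k \<tau> = 0" if "\<mu> \<ge> 1 \<and> \<nu> \<ge> 1 \<and> \<rho> \<ge> 1 \<and> \<mu> + \<nu> + \<rho> = l" for \<mu> \<nu> \<rho>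
    proof -
      have "\<mu> \<le> l - 2" "\<nu> \<le> l - 2" "\<rho> \<le> l - 2" using that by linarith+
      moreover have "1 \<le> i \<or> 1 \<le> j \<or> 1 \<le> k" using \<open>ijk \<noteq> _\<close> ijk by auto
      ultimately show ?thesis using assms by auto
    qed
    then show ?thesis unfolding cubic_term_def ijk by (auto intro!: sum.neutral)
  qed
  have "(cubic_term f l m \<tau> has_sum sum (cubic_term f l m \<tau>) {(0, 0, 0)}) {(0, 0, 0)}"
    by (intro has_sum_finite) simp
  then have "(cubic_term f l m \<tau> has_sum cubic_term f l m \<tau> (0, 0, 0)) UNIV"
    by (subst has_sum_cong_neutral[where T = "{(0, 0, 0)}" and f = "cubic_term f l m \<tau>"]) (use 0 in auto)
  then show "cubic_term f l m \<tau> summable_on UNIV"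
    "(\<Sum>\<^sub>\<infinity>ijk. cubic_term f l m \<tau> ijk) = (if m = 0 then cubic_sum (\<lambda>\<mu>. f \<mu> 0) l \<tau> else 0)"
    by (auto simp: summable_on_def infsumI cubic_term_def coupling_0 cubic_sum_def)
qed

lemma sum_shifts: "(\<Sum>(\<mu>, \<nu>) \<in> {(\<mu>, \<nu>). \<nu> \<ge> 1 \<and> \<mu> + \<nu> = l}. G \<mu> \<nu>) = (\<Sum>\<nu>=1..l. G (l - \<nu>) \<nu>)"
  for l :: nat
  by (rule sum.reindex_bij_witness[where i = "\<lambda>\<nu>. (l - \<nu>, \<nu>)" and j = snd]) auto

lemma source_switched_off:
  assumes off: "\<And>\<mu> i \<tau>. \<mu> \<le> l - 2 \<Longrightarrow> 1 \<le> i \<Longrightarrow> f \<mu> i \<tau> = 0"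
    and f: "\<And>\<tau>. f 0 0 \<tau> = 0" "\<And>\<tau>. f 1 0 \<tau> = cos \<tau>"
    and "\<theta> 1 = 0" "2 \<le> l"
  shows "source \<theta> f l m \<tau> = (if m = 0 then residual \<theta> (\<lambda>\<mu>. f \<mu> 0) l \<tau> + \<theta> (l - 1) * cos \<tau> else 0)"
proof -
  have cubic: "(\<Sum>\<^sub>\<infinity>ijk. cubic_term f l m \<tau> ijk) = (if m = 0 then cubic_sum (\<lambda>\<mu>. f \<mu> 0) l \<tau> else 0)"
    by (rule cubic_term_switched_off(2)[OF off])
  define G where "G \<nu> = \<theta> \<nu> * deriv (deriv (f (l - \<nu>) m)) \<tau>" for \<nu>
  have src: "source \<theta> f l m \<tau> = - (if m = 0 then cubic_sum (\<lambda>\<mu>. f \<mu> 0) l \<tau> else 0) - (\<Sum>\<nu>=1..l. G \<nu>)"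
    unfolding source_def cubic sum_shifts[of "\<lambda>\<mu> \<nu>. \<theta> \<nu> * deriv (deriv (f \<mu> m)) \<tau>"] G_def ..
  show ?thesis
  proof (cases "m = 0")
    case True
    have "f 0 0 = (\<lambda>_. 0)" "f 1 0 = cos"
      using f by auto
    moreover have "deriv (deriv cos) \<tau> = - cos \<tau>"
      using deriv2_cos_mult[of 1 1] by simp
    ultimately have G: "G l = 0" "G (l - 1) = - \<theta> (l - 1) * cos \<tau>" "G 1 = 0"
      using \<open>2 \<le> l\<close> \<open>\<theta> 1 = 0\<close> True unfolding G_def by (simp_all del: One_nat_def)
    \<comment> \<open>The indices 1 and l contribute nothing. For l = 2 the index l - 1 is 1 itself
      and the range from 2 to l - 2 is empty.\<close>
    have "(\<Sum>\<nu>=1..l. G \<nu>) = (\<Sum>\<nu>\<in>insert (l - 1) {2..l - 2}. G \<nu>)"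
    proof (rule sum.mono_neutral_right)
      show "\<forall>\<nu>\<in>{1..l} - insert (l - 1) {2..l - 2}. G \<nu> = 0"
      proof
        fix \<nu> assume "\<nu> \<in> {1..l} - insert (l - 1) {2..l - 2}"
        then have "\<nu> = 1 \<or> \<nu> = l" by auto
        then show "G \<nu> = 0" using G by auto
      qed
    qed (use \<open>2 \<le> l\<close> in auto)
    also have "\<dots> = G (l - 1) + (\<Sum>\<nu>=2..l - 2. G \<nu>)"
      using \<open>2 \<le> l\<close> by (subst sum.insert) auto
    finally show ?thesis
      unfolding src residual_def using True G by (simp add: G_def)
  next
    case False
    \<comment> \<open>Mode \<open>m\<close> need not vanish at order \<open>l - 1\<close>, so the
      term \<nu> = 1 is removed by \<theta> 1 = 0; all other terms have order at most
      \<open>l - 2\<close>.\<close>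
    have "G \<nu> = 0" if "\<nu> \<in> {1..l}" for \<nu>
    proof (cases "\<nu> = 1")
      case True
      then show ?thesis using \<open>\<theta> 1 = 0\<close> unfolding G_def by simp
    next
      case False
      then have "f (l - \<nu>) m = (\<lambda>_. 0)"
        using that \<open>m \<noteq> 0\<close> by (intro ext off) auto
      then show ?thesis unfolding G_def by simp
    qed
    then show ?thesis unfolding src using False by simp
  qed
qed

section \<open>The zeroth mode\<close>

text \<open>The argument \<open>r l \<alpha>\<close> is the coefficient of the harmonic \<open>\<alpha>\<close> in the residual of order \<open>l\<close>.
  The resonant harmonic \<open>\<alpha> = 0\<close> drops out of the sum, because its denominator is 0 and so its quotient is 0.\<close>

definition profile :: "(nat \<Rightarrow> nat \<Rightarrow> real) \<Rightarrow> (nat \<Rightarrow> real) \<Rightarrow> nat \<Rightarrow> real \<Rightarrow> real" where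
  "profile r b l \<tau> = b l * cos \<tau> +
     (\<Sum>\<alpha>\<le>(l - 1) div 2. r l \<alpha> / (1 - (1 + 2 * real \<alpha>)\<^sup>2) * (odd_harmonic \<alpha> \<tau> - cos \<tau>))"

text \<open>The zeroth mode's source at order \<open>Suc \<nu>\<close> contains \<theta> \<nu> times
  cosine, so this value cancels the resonant harmonic of the residual of that order.\<close>

definition shift :: "(nat \<Rightarrow> nat \<Rightarrow> real) \<Rightarrow> nat \<Rightarrow> real" where
  "shift r \<nu> = - r (Suc \<nu>) 0"

text \<open>One step of a course-of-values recursion: the coefficients at lower orders enter through
  both the profiles and the shifts, and determine the residual at order \<open>l\<close>.\<close>

definition next_coeffs :: "(nat \<Rightarrow> real) \<Rightarrow> (nat \<Rightarrow> nat \<Rightarrow> real) \<Rightarrow> nat \<Rightarrow> nat \<Rightarrow> real" where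
  "next_coeffs b r l = odd_cos_coeffs ((l - 1) div 2) (residual (shift r) (profile r b) l)"

definition res_coeffs :: "(nat \<Rightarrow> real) \<Rightarrow> nat \<Rightarrow> nat \<Rightarrow> real" where
  "res_coeffs b = wfrec less_than (next_coeffs b)"

lemma profile_cong: "r l = r' l \<Longrightarrow> b l = b' l \<Longrightarrow> profile r b l = profile r' b' l"
  unfolding profile_def by (intro ext) simp

text \<open>Profiles are read up to order \<open>l - 2\<close>; shifts are read up to index
  \<open>l - 2\<close>, hence coefficients up to order \<open>l - 1\<close>. This makes the
  well-founded recursion admissible.\<close>

lemma next_coeffs_cong:
  assumes "\<And>k. k < l \<Longrightarrow> r k = r' k" "\<And>k. k \<in> {1..l - 2} \<Longrightarrow> b k = b' k"
  shows "next_coeffs b r l = next_coeffs b' r' l"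
proof -
  have "residual (shift r) (profile r b) l = residual (shift r') (profile r' b') l"
    using assms by (intro residual_cong profile_cong) (auto simp: shift_def)
  then show ?thesis unfolding next_coeffs_def by simp
qed

lemma res_coeffs_rec:
  "res_coeffs b l = odd_cos_coeffs ((l - 1) div 2) (residual (shift (res_coeffs b)) (profile (res_coeffs b) b) l)"
proof -
  have "adm_wf less_than (next_coeffs b)"
    unfolding adm_wf_def by (auto intro!: next_coeffs_cong)
  from wfrec_fixpoint[OF wf_less_than this] have "res_coeffs b = next_coeffs b (res_coeffs b)"
    unfolding res_coeffs_def .
  then show ?thesis unfolding next_coeffs_def by metis
qed

text \<open>By induction on the order, free initial values enter only through the profiles up to
  order \<open>l - 2\<close>. Both dependence claims of the theorem follow from this.\<close>

lemma res_coeffs_cong: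
  assumes "\<And>k. k \<in> {1..l - 2} \<Longrightarrow> b k = b' k"
  shows "res_coeffs b l = res_coeffs b' l"
  using assms
proof (induction l rule: less_induct)
  case (less l)
  have "res_coeffs b k = res_coeffs b' k" if "k < l" for k
    by (rule less.IH[OF that]) (use that in \<open>auto intro: less.prems\<close>)
  then have "next_coeffs b (res_coeffs b) l = next_coeffs b' (res_coeffs b') l"
    using less.prems by (rule next_coeffs_cong)
  then show ?case
    unfolding next_coeffs_def by (simp only: res_coeffs_rec[symmetric])
qed

text \<open>The case \<open>\<alpha> = 0\<close> collects the multiples of \<open>cos \<tau>\<close> that \<^const>\<open>profile\<close> subtracts to keep the initial value \<open>b l\<close>.\<close>

definition corr_coeff :: "nat \<Rightarrow> nat \<Rightarrow> (nat \<Rightarrow> real) \<Rightarrow> real" where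
  "corr_coeff l \<alpha> b =
     (if \<alpha> = 0 then - (\<Sum>\<beta>\<le>(l - 1) div 2. res_coeffs b l \<beta> / (1 - (1 + 2 * real \<beta>)\<^sup>2))
      else res_coeffs b l \<alpha> / (1 - (1 + 2 * real \<alpha>)\<^sup>2))"

lemma profile_eq_harmonics:
  "profile (res_coeffs b) b l \<tau> =
    (\<Sum>\<alpha>\<le>(l - 1) div 2. ((if \<alpha> = 0 then b l else 0) + corr_coeff l \<alpha> b) * odd_harmonic \<alpha> \<tau>)"
proof -
  define n where "n = (l - 1) div 2"
  define q where "q \<alpha> = res_coeffs b l \<alpha> / (1 - (1 + 2 * real \<alpha>)\<^sup>2)" for \<alpha>
  have "q 0 = 0" unfolding q_def by simp
  have "(\<Sum>\<alpha>\<le>n. ((if \<alpha> = 0 then b l else 0) + corr_coeff l \<alpha> b) * odd_harmonic \<alpha> \<tau>) =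
      (\<Sum>\<alpha>\<le>n. (if \<alpha> = 0 then (b l - sum q {..n}) * cos \<tau> else 0) + q \<alpha> * odd_harmonic \<alpha> \<tau>)"
    using \<open>q 0 = 0\<close>
    by (intro sum.cong refl) (auto simp: corr_coeff_def q_def n_def odd_harmonic_def)
  also have "\<dots> = (b l - sum q {..n}) * cos \<tau> + (\<Sum>\<alpha>\<le>n. q \<alpha> * odd_harmonic \<alpha> \<tau>)"
    by (simp add: sum.distrib)
  also have "\<dots> = profile (res_coeffs b) b l \<tau>"
    unfolding profile_def n_def[symmetric] q_def[symmetric]
    by (simp add: algebra_simps sum_subtractf sum_distrib_left)
  finally show ?thesis unfolding n_def ..
qed

lemma profile_eq_corr_coeff:
  "profile (res_coeffs b) b l \<tau> =
    b l * cos \<tau> + (\<Sum>\<alpha>=0..(l - 1) div 2. corr_coeff l \<alpha> b * cos ((1 + 2 * real \<alpha>) * \<tau>))"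
proof -
  have "profile (res_coeffs b) b l \<tau> =
      (\<Sum>\<alpha>\<le>(l - 1) div 2. (if \<alpha> = 0 then b l * cos \<tau> else 0) + corr_coeff l \<alpha> b * odd_harmonic \<alpha> \<tau>)"
    unfolding profile_eq_harmonics
    by (intro sum.cong refl) (auto simp: odd_harmonic_def algebra_simps)
  then show ?thesis
    by (simp add: sum.distrib odd_harmonic_def atLeast0AtMost)
qed

section \<open>Harmonic content of the residual and the equation of the profile\<close>

lemma odd_cos_sum_profile: "odd_cos_sum ((l - 1) div 2) (profile (res_coeffs b) b l)"
  unfolding odd_cos_sum_def by (intro exI allI) (rule profile_eq_harmonics)

text \<open>The degree count closes: for \<mu> + \<nu> + \<rho> = l, the three bounds (\<mu> - 1)
  div 2, (\<nu> - 1) div 2, (\<rho> - 1) div 2 plus 1 add up to at most (l - 1) div 2.\<close>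

lemma odd_cos_sum_residual:
  "odd_cos_sum ((l - 1) div 2) (residual \<theta> (profile (res_coeffs b) b) l)"
proof -
  have "odd_cos_sum ((l - 1) div 2) (cubic_sum (profile (res_coeffs b) b) l)"
    unfolding cubic_sum_def case_prod_unfold
    by (intro odd_cos_sum_sum odd_cos_sum_mult3[OF odd_cos_sum_profile odd_cos_sum_profile odd_cos_sum_profile])
      auto
  moreover have "odd_cos_sum ((l - 1) div 2)
      (\<lambda>\<tau>. \<Sum>\<nu>=2..l - 2. \<theta> \<nu> * deriv (deriv (profile (res_coeffs b) b (l - \<nu>))) \<tau>)"
    by (intro odd_cos_sum_sum odd_cos_sum_scale odd_cos_sum_mono[OF odd_cos_sum_deriv2[OF odd_cos_sum_profile]])
      auto
  ultimately have "odd_cos_sum ((l - 1) div 2) (\<lambda>\<tau>. - 1 * cubic_sum (profile (res_coeffs b) b) l \<tau> -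
      (\<Sum>\<nu>=2..l - 2. \<theta> \<nu> * deriv (deriv (profile (res_coeffs b) b (l - \<nu>))) \<tau>))"
    by (intro odd_cos_sum_diff odd_cos_sum_scale)
  then show ?thesis unfolding residual_def by simp
qed

lemmas profile_deriv = odd_cos_sum_deriv[where h = "profile (res_coeffs b) b l" and n = "(l - 1) div 2"
    and c = "\<lambda>\<alpha>. (if \<alpha> = 0 then b l else 0) + corr_coeff l \<alpha> b", OF profile_eq_harmonics] for b l

lemma profile_regular:
  "profile (res_coeffs b) b l differentiable (at \<tau>)"
  "deriv (profile (res_coeffs b) b l) differentiable (at \<tau>)"
  "deriv (profile (res_coeffs b) b l) 0 = 0"
  by (rule profile_deriv)+

lemma profile_0: "profile r b l 0 = b l"
  unfolding profile_def odd_harmonic_def by simp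

text \<open>The oscillator multiplies harmonic \<alpha> by the denominator used in
  \<open>profile\<close>, which restores the residual's coefficient. It annihilates harmonic 0,
  whose coefficient the shift must cancel.\<close>

lemma profile_ode:
  assumes "1 \<le> l"
  shows "deriv (deriv (profile (res_coeffs b) b l)) \<tau> + profile (res_coeffs b) b l \<tau> =
    residual (shift (res_coeffs b)) (profile (res_coeffs b) b) l \<tau> + shift (res_coeffs b) (l - 1) * cos \<tau>"
proof -
  define n where "n = (l - 1) div 2"
  let ?r = "res_coeffs b l"
  let ?c = "\<lambda>\<alpha>. (if \<alpha> = 0 then b l else 0) + corr_coeff l \<alpha> b"
  have nonres: "1 - (1 + 2 * real \<alpha>)\<^sup>2 \<noteq> 0" if "\<alpha> \<noteq> 0" for \<alpha>
  proof -
    have "1 < (1 + 2 * real \<alpha>)\<^sup>2"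
      using that by (intro one_less_power) auto
    then show ?thesis by auto
  qed
  have coeffs: "?r = odd_cos_coeffs n (residual (shift (res_coeffs b)) (profile (res_coeffs b) b) l)"
    unfolding n_def by (rule res_coeffs_rec)
  have "deriv (deriv (profile (res_coeffs b) b l)) \<tau> + profile (res_coeffs b) b l \<tau> =
      (\<Sum>\<alpha>\<le>n. - (1 + 2 * real \<alpha>)\<^sup>2 * ?c \<alpha> * odd_harmonic \<alpha> \<tau> + ?c \<alpha> * odd_harmonic \<alpha> \<tau>)"
    unfolding profile_deriv(4) profile_eq_harmonics n_def sum.distrib ..
  \<comment> \<open>At \<alpha> = 0 the left side is 0; it is written as the resonant term minus
    itself to complete the residual's expansion.\<close>
  also have "\<dots> = (\<Sum>\<alpha>\<le>n. ?r \<alpha> * odd_harmonic \<alpha> \<tau> + (if \<alpha> = 0 then - ?r 0 * cos \<tau> else 0))"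
  proof (intro sum.cong refl)
    fix \<alpha>
    show "- (1 + 2 * real \<alpha>)\<^sup>2 * ?c \<alpha> * odd_harmonic \<alpha> \<tau> + ?c \<alpha> * odd_harmonic \<alpha> \<tau> =
        ?r \<alpha> * odd_harmonic \<alpha> \<tau> + (if \<alpha> = 0 then - ?r 0 * cos \<tau> else 0)"
    proof (cases "\<alpha> = 0")
      case True
      then show ?thesis by (simp add: odd_harmonic_def algebra_simps)
    next
      case False
      have "- (1 + 2 * real \<alpha>)\<^sup>2 * ?c \<alpha> * odd_harmonic \<alpha> \<tau> + ?c \<alpha> * odd_harmonic \<alpha> \<tau> =
          ((1 - (1 + 2 * real \<alpha>)\<^sup>2) * corr_coeff l \<alpha> b) * odd_harmonic \<alpha> \<tau>"
        using False by (simp add: left_diff_distrib)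
      also have "(1 - (1 + 2 * real \<alpha>)\<^sup>2) * corr_coeff l \<alpha> b = ?r \<alpha>"
        using False nonres[OF False] by (simp add: corr_coeff_def)
      finally show ?thesis using False by simp
    qed
  qed
  also have "\<dots> = (\<Sum>\<alpha>\<le>n. ?r \<alpha> * odd_harmonic \<alpha> \<tau>) - ?r 0 * cos \<tau>"
    by (simp add: sum.distrib)
  also have "(\<Sum>\<alpha>\<le>n. ?r \<alpha> * odd_harmonic \<alpha> \<tau>) =
      residual (shift (res_coeffs b)) (profile (res_coeffs b) b) l \<tau>"
    unfolding coeffs unfolding n_def by (rule odd_cos_sum_coeffs[OF odd_cos_sum_residual, symmetric])
  \<comment> \<open>\<open>shift\<close> looks one order ahead, and \<open>Suc (l - 1)\<close> is
    \<open>l\<close> because \<open>l\<close> is positive.\<close>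
  also have "?r 0 = - shift (res_coeffs b) (l - 1)"
    using assms by (simp add: shift_def)
  finally show ?thesis by simp
qed

text \<open>The residual of order 2 is zero: no three positive orders add up to 2, and its shift sum
  is empty.\<close>

lemma shift_1: "shift (res_coeffs b) 1 = 0"
proof -
  have no_triples: "{(\<mu>::nat, \<nu>, \<rho>). \<mu> \<ge> 1 \<and> \<nu> \<ge> 1 \<and> \<rho> \<ge> 1 \<and> \<mu> + \<nu> + \<rho> = 2} = {}"
    by auto
  let ?R = "residual (shift (res_coeffs b)) (profile (res_coeffs b) b) 2"
  have "?R 0 = 0"
    unfolding residual_def cubic_sum_def no_triples by simp
  \<comment> \<open>The expansion at order 2 has the single harmonic 0, so evaluating at time 0
    reads off its coefficient.\<close>
  moreover have "?R 0 = odd_cos_coeffs 0 ?R 0"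
    using odd_cos_sum_coeffs[OF odd_cos_sum_residual[of 2 "shift (res_coeffs b)" b], of 0]
    by (simp add: odd_harmonic_def)
  moreover have "res_coeffs b 2 = odd_cos_coeffs 0 ?R"
    using res_coeffs_rec[of b 2] by simp
  ultimately show ?thesis
    unfolding shift_def by (simp add: numeral_2_eq_2)
qed

section \<open>Solution of the hierarchy\<close>

definition solution :: "(nat \<Rightarrow> nat \<Rightarrow> real) \<Rightarrow> nat \<Rightarrow> nat \<Rightarrow> real \<Rightarrow> real" where
  "solution a p m =
     (if m = 0 then profile (res_coeffs (\<lambda>\<sigma>. a \<sigma> 0)) (\<lambda>\<sigma>. a \<sigma> 0) p else (\<lambda>\<tau>. a p m * cos (omega m * \<tau>)))"

lemma solution_regular:
  "solution a p m differentiable (at \<tau>)" "deriv (solution a p m) differentiable (at \<tau>)"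
  "solution a p m 0 = a p m" "deriv (solution a p m) 0 = 0"
proof -
  have *: "(\<lambda>\<tau>. a p m * cos (omega m * \<tau>)) differentiable (at \<tau>)"
    "(\<lambda>\<tau>. - a p m * omega m * sin (omega m * \<tau>)) differentiable (at \<tau>)" for \<tau>
    using DERIV_cos_mult[of "a p m" "omega m" \<tau>] DERIV_sin_mult[of "- a p m * omega m" "omega m" \<tau>]
      real_differentiable_def by blast+
  show "solution a p m differentiable (at \<tau>)" "deriv (solution a p m) differentiable (at \<tau>)"
    "solution a p m 0 = a p m" "deriv (solution a p m) 0 = 0"
    using * by (auto simp: solution_def profile_regular profile_0 deriv_cos_mult)
qed

lemma solution_initial: "initial_data a (solution a)"
  unfolding initial_data_def using solution_regular by blast

definition chosen_shift :: "nat \<Rightarrow> (nat \<Rightarrow> real) \<Rightarrow> real" where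
  "chosen_shift \<nu> b = shift (res_coeffs b) \<nu>"

text \<open>At orders 0 and 1 the sum in \<open>profile\<close> has only the vanishing term \<alpha>
  = 0, so the prescribed initial values determine everything.\<close>

lemma solution_low_order:
  assumes "choices_in_force N chosen_shift a \<theta>"
  shows "solution a 0 m \<tau> = 0" "solution a 1 m \<tau> = (if m = 0 then cos \<tau> else 0)"
  using assms unfolding choices_in_force_def solution_def profile_def
  by auto

lemma solution_switched_off:
  assumes "choices_in_force N chosen_shift a \<theta>" "2 \<le> l" "l \<le> N" "\<mu> \<le> l - 2" "1 \<le> i"
  shows "solution a \<mu> i \<tau> = 0"
proof -
  have "\<forall>\<xi>\<in>{2..N}. \<forall>m\<ge>1. a (\<xi> - 2) m = 0"
    using assms(1) unfolding choices_in_force_def by blast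
  \<comment> \<open>The choice made at order \<mu> + 2 is in force because \<mu> + 2 \<le> l \<le>
    N.\<close>
  then have "a (\<mu> + 2 - 2) i = 0"
    using assms by (elim ballE[of _ _ "\<mu> + 2"]) auto
  then show ?thesis using \<open>1 \<le> i\<close> unfolding solution_def by simp
qed

lemma solution_ode:
  assumes ch: "choices_in_force N chosen_shift a \<theta>" and l: "2 \<le> l" "l \<le> N"
  shows "deriv (deriv (solution a l m)) \<tau> + (omega m)\<^sup>2 * solution a l m \<tau> = source \<theta> (solution a) l m \<tau>"
proof -
  define b where "b = (\<lambda>\<sigma>. a \<sigma> 0)"
  have th: "\<theta> \<nu> = shift (res_coeffs b) \<nu>" if "1 \<le> \<nu>" "\<nu> \<le> N - 1" for \<nu>
    using ch that unfolding choices_in_force_def chosen_shift_def b_def by auto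
  have th1: "\<theta> 1 = 0"
    using th[of 1] shift_1 l by auto
  have src: "source \<theta> (solution a) l m \<tau> =
      (if m = 0 then residual \<theta> (\<lambda>\<mu>. solution a \<mu> 0) l \<tau> + \<theta> (l - 1) * cos \<tau> else 0)"
    by (rule source_switched_off)
      (use l th1 solution_switched_off[OF ch l] solution_low_order[OF ch] in auto)
  show ?thesis
  proof (cases "m = 0")
    case True
    have "residual \<theta> (\<lambda>\<mu>. solution a \<mu> 0) l = residual (shift (res_coeffs b)) (profile (res_coeffs b) b) l"
      using th l by (intro residual_cong) (auto simp: solution_def b_def)
    moreover have "\<theta> (l - 1) = shift (res_coeffs b) (l - 1)"
      using l by (intro th) auto
    moreover have "solution a l 0 = profile (res_coeffs b) b l"
      unfolding solution_def b_def by simp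
    ultimately show ?thesis
      using True profile_ode[of l b \<tau>] l unfolding src by (simp add: omega_def)
  next
    case False
    then show ?thesis
      unfolding src by (simp add: solution_def deriv2_cos_mult)
  qed
qed

lemma solution_hierarchy:
  assumes ch: "choices_in_force N chosen_shift a \<theta>"
  shows "hierarchy_upto N \<theta> (solution a)"
  unfolding hierarchy_upto_def
proof (intro conjI allI impI; (elim conjE)?)
  show "\<theta> 0 = 1" using ch unfolding choices_in_force_def by blast
  fix l m \<tau> assume "2 \<le> l" "l \<le> N"
  then show "cubic_term (solution a) l m \<tau> summable_on UNIV"
    using solution_switched_off[OF ch] by (intro cubic_term_switched_off) auto
qed (use solution_low_order[OF ch] solution_regular solution_ode[OF ch] in auto)

section \<open>Uniqueness for the hierarchy with given initial data\<close>

lemma source_cong: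
  assumes g: "\<And>p m. p < l \<Longrightarrow> f p m = g p m"
  shows "source \<theta> f l m \<tau> = source \<theta> g l m \<tau>"
proof -
  have "cubic_term f l m \<tau> = cubic_term g l m \<tau>"
    unfolding cubic_term_def by (intro ext) (auto intro!: sum.cong simp: g)
  moreover have "(\<Sum>(\<mu>, \<nu>) \<in> {(\<mu>, \<nu>). \<nu> \<ge> 1 \<and> \<mu> + \<nu> = l}. \<theta> \<nu> * deriv (deriv (f \<mu> m)) \<tau>) =
      (\<Sum>(\<mu>, \<nu>) \<in> {(\<mu>, \<nu>). \<nu> \<ge> 1 \<and> \<mu> + \<nu> = l}. \<theta> \<nu> * deriv (deriv (g \<mu> m)) \<tau>)"
    by (intro sum.cong refl) (auto simp: g)
  ultimately show ?thesis unfolding source_def by simp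
qed

text \<open>Induction on the order: the source involves strictly lower orders only, so both
  functions solve the same forced oscillator with the same data.\<close>

lemma hierarchy_unique:
  assumes f: "hierarchy_upto N \<theta> f" "initial_data a f"
    and g: "hierarchy_upto N \<theta> g" "initial_data a g"
    and "p \<le> N"
  shows "f p m = g p m"
  using \<open>p \<le> N\<close>
proof (induction p arbitrary: m rule: less_induct)
  case (less p)
  consider "p = 0" | "p = 1" | "2 \<le> p" by linarith
  then show ?case
  proof cases
    case 3
    have src: "source \<theta> f p m \<tau> = source \<theta> g p m \<tau>" for \<tau>
      using less by (intro source_cong) auto
    show ?thesis
    proof (rule oscillator_unique[where w = "omega m" and s = "source \<theta> g p m"])
      show "omega m \<noteq> 0" unfolding omega_def by linarith
    qed (use f g 3 less.prems src in \<open>auto simp: hierarchy_upto_def initial_data_def\<close>)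
  qed (use f g in \<open>auto simp: hierarchy_upto_def fun_eq_iff\<close>)
qed

theorem theorem4p1:
  "\<exists>(c :: nat \<Rightarrow> nat \<Rightarrow> (nat \<Rightarrow> real) \<Rightarrow> real) (\<Theta> :: nat \<Rightarrow> (nat \<Rightarrow> real) \<Rightarrow> real).
     (\<forall>l\<ge>2. \<forall>\<alpha>\<le>(l - 1) div 2. depends_only_on {1..l - 2} (c l \<alpha>)) \<and>
     (\<forall>\<nu>\<ge>1. depends_only_on {1..\<nu>} (\<Theta> \<nu>)) \<and>
     (\<forall>l\<ge>2. \<forall>a \<theta>. choices_in_force l \<Theta> a \<theta> \<longrightarrow>
        (\<exists>f. hierarchy_upto l \<theta> f \<and> initial_data a f) \<and>
        (\<forall>f. hierarchy_upto l \<theta> f \<and> initial_data a f \<longrightarrow>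
           (\<forall>\<tau>. f l 0 \<tau> = f l 0 0 * cos \<tau> +
              (\<Sum>\<alpha>=0..(l - 1) div 2. c l \<alpha> (\<lambda>\<sigma>. f \<sigma> 0 0) * cos ((1 + 2 * real \<alpha>) * \<tau>))) \<and>
           (\<forall>m\<ge>1. \<forall>\<tau>. f l m \<tau> = f l m 0 * cos (omega m * \<tau>))))"
proof (rule exI[of _ corr_coeff], rule exI[of _ chosen_shift], intro conjI allI impI)
  fix l \<alpha> :: nat
  show "depends_only_on {1..l - 2} (corr_coeff l \<alpha>)"
    unfolding depends_only_on_def
  proof (intro allI impI)
    fix b b' :: "nat \<Rightarrow> real" assume "\<forall>\<sigma>\<in>{1..l - 2}. b \<sigma> = b' \<sigma>"
    then have "res_coeffs b l = res_coeffs b' l"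
      by (intro res_coeffs_cong) auto
    then show "corr_coeff l \<alpha> b = corr_coeff l \<alpha> b'"
      unfolding corr_coeff_def by simp
  qed
next
  fix \<nu> :: nat
  show "depends_only_on {1..\<nu>} (chosen_shift \<nu>)"
    unfolding depends_only_on_def
  proof (intro allI impI)
    fix b b' :: "nat \<Rightarrow> real" assume "\<forall>\<sigma>\<in>{1..\<nu>}. b \<sigma> = b' \<sigma>"
    \<comment> \<open>The shift \<theta> \<nu> is fixed at order \<nu> + 1, whose residual reads
      initial values of orders 1 to \<nu> - 1.\<close>
    then have "res_coeffs b (Suc \<nu>) = res_coeffs b' (Suc \<nu>)"
      by (intro res_coeffs_cong) auto
    then show "chosen_shift \<nu> b = chosen_shift \<nu> b'"
      unfolding chosen_shift_def shift_def by simp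
  qed
next
  fix l a \<theta> assume ch: "choices_in_force l chosen_shift a \<theta>"
  show "\<exists>f. hierarchy_upto l \<theta> f \<and> initial_data a f"
    using solution_hierarchy[OF ch] solution_initial by blast
  fix f assume f: "hierarchy_upto l \<theta> f \<and> initial_data a f"
  \<comment> \<open>By uniqueness every solution coincides at order \<open>l\<close> with the
    constructed one, so both formulas can be read off from \<open>solution\<close>.\<close>
  then have sol: "f l m = solution a l m" for m
    using solution_hierarchy[OF ch] solution_initial by (blast intro: hierarchy_unique)
  have f0: "f p m 0 = a p m" for p m
    using f unfolding initial_data_def by blast
  show "f l 0 \<tau> = f l 0 0 * cos \<tau> +
      (\<Sum>\<alpha>=0..(l - 1) div 2. corr_coeff l \<alpha> (\<lambda>\<sigma>. f \<sigma> 0 0) * cos ((1 + 2 * real \<alpha>) * \<tau>))" for \<tau>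
    unfolding f0 unfolding sol solution_def by (simp add: profile_eq_corr_coeff)
  show "f l m \<tau> = f l m 0 * cos (omega m * \<tau>)" if "1 \<le> m" for m \<tau>
    unfolding f0 unfolding sol solution_def using that by simp
qed

end
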